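(* Let $q$ and $b$ be integers such that $q\ge 2$, $q$ divides $b$, and $b/q\ge 2$. Let $\tau:\Sigma_q^\ast\to\{-1,0,\ldots,b-2\}$ be a maximal tree mapping, $\Lambda:=\Lambda(\tau)$, and let $K>1$ be an integer coprime with $b$. Then $K\Lambda=\{K\lambda:\lambda\in\Lambda\}$ is not a maximal orthogonal set of the Cantor measure $\mu_{q,b}$ if and only if there exist $\delta\in\Sigma_q^\infty$, a nonnegative integer $M$ and a positive integer $N$ such that $\{\tau(\delta|_n)\}_{n=M+1}^\infty$ is periodic with period $N$, i.e. $$\tau(\delta|_n)=\tau(\delta|_{n+N}),\qquad n\ge M+1,$$ and such that the word $\omega_1\omega_2\cdots\omega_N$ defined by $\omega_j=\tau(\delta|_{M+j})$, $1\le j\le N$, satisfies $$\frac iK=\sum_{n=1}^\infty\sum_{j=1}^N\omega_jb^{j-Nn-1}=\frac{\sum_{j=1}^N\omega_jb^{j-1}}{b^N-1}$$ for some $i\in\mathbb Z\setminus\{0\}$.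
   Context: Cantor measure: $\mu_{q,b}$ is the unique Borel probability measure on $\mathbb R$ with $\mu_{q,b}=\frac1q\sum_{i=0}^{q-1}\mu_{q,b}(f_i^{-1}(\cdot))$, where $f_i(x)=x/b+i/q$, $0\le i\le q-1$. A countable set $\Lambda\subset\mathbb R$ is an orthogonal set of a probability measure $\mu$ if the functions $e^{-2\pi i\lambda x}$, $\lambda\in\Lambda$, are pairwise orthogonal in $L^2(\mu)$, and a maximal orthogonal set if moreover no $\Lambda\cup\{\lambda_0\}$ with $\lambda_0\in\mathbb R\setminus\Lambda$ is an orthogonal set of $\mu$. Words: $\Sigma_q=\{0,1,\ldots,q-1\}$; $\Sigma_q^n$ is the set of words of length $n$ over $\Sigma_q$; $\Sigma_q^\ast=\bigcup_{1\le n<\infty}\Sigma_q^n$; $\Sigma_q^\infty$ is the set of infinite words. Juxtaposition denotes concatenation; $0^k$ is the word of $k$ zeros and $0^\infty=000\cdots$. For $k\ge1$, $\delta|_k$ is the prefix of length $k$ of $\delta$ if $\delta\in\Sigma_q^\infty$, and the prefix of length $k$ of $\delta0^\infty$ if $\delta\in\Sigma_q^\ast$. Tree mapping: a map $\tau:\Sigma_q^\ast\to\{-1,0,\ldots,b-2\}$ with (i) $\tau(0^n)=0$ for all $n\ge1$; (ii) $\tau(\delta)\in\delta_n+q\mathbb Z$ for every $\delta=\delta_1\cdots\delta_n\in\Sigma_q^n$, $n\ge1$. It is maximal if (iii) for any $\delta\in\Sigma_q^\ast$ there exists $\delta'\in\Sigma_q^\ast$ such that $\tau((\delta\delta')|_n)=0$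 for all sufficiently large $n$. $\Lambda(\tau):=\{\sum_{n=1}^\infty\tau(\delta|_n)b^{n-1}:\ \delta\in\Sigma_q^\ast\text{ such that }\tau(\delta|_m)=0\text{ for all sufficiently large }m\}$. *)

theory Defs
  imports "HOL-Probability.Probability"
begin

section \<open>The Cantor measure\<close>

definition cantor_map :: "int \<Rightarrow> int \<Rightarrow> int \<Rightarrow> real \<Rightarrow> real" where
  "cantor_map q b i x = x / of_int b + of_int i / of_int q"

definition is_cantor_measure :: "int \<Rightarrow> int \<Rightarrow> real measure \<Rightarrow> bool" where
  "is_cantor_measure q b \<mu> \<longleftrightarrow>
     sets \<mu> = sets borel \<and> prob_space \<mu> \<and>
     (\<forall>A\<in>sets borel. measure \<mu> A =
        1 / of_int q * (\<Sum>i\<in>{0..q - 1}. measure \<mu> (cantor_map q b i -` A)))"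

definition cantor_measure :: "int \<Rightarrow> int \<Rightarrow> real measure" where
  "cantor_measure q b = (THE \<mu>. is_cantor_measure q b \<mu>)"


subsection \<open>Existence and uniqueness of the Cantor measure\<close>

definition digit_pmf :: "int \<Rightarrow> int pmf" where
  "digit_pmf q = pmf_of_set {0..q - 1}"

lemma cantor_map_measurable [measurable]: "cantor_map q b i \<in> borel_measurable borel"
  unfolding cantor_map_def by measurable

lemma cantor_map_vimage_sets:
  assumes "A \<in> sets borel"
  shows "cantor_map q b i -` A \<in> sets borel"
  using measurable_sets[OF cantor_map_measurable assms, of q b i] by simp

lemma cantor_pair_measurable:
  assumes "sets \<mu> = sets borel"
  shows "(\<lambda>(i, x). cantor_map q b i x) \<in> measurable (measure_pmf (digit_pmf q) \<Otimes>\<^sub>M \<mu>) borel"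
proof -
  have [measurable_cong]: "sets \<mu> = sets borel" by fact
  show ?thesis unfolding cantor_map_def by measurable
qed

lemma is_cantor_measure_iff_distr:
  assumes q: "q \<ge> 1" and s: "sets \<mu> = sets borel" and p: "prob_space \<mu>"
  shows "is_cantor_measure q b \<mu> \<longleftrightarrow>
    \<mu> = distr (measure_pmf (digit_pmf q) \<Otimes>\<^sub>M \<mu>) borel (\<lambda>(i, x). cantor_map q b i x)"
    (is "_ \<longleftrightarrow> \<mu> = ?D")
proof -
  interpret prob_space \<mu> by fact
  interpret P: pair_prob_space "measure_pmf (digit_pmf q)" \<mu> ..
  note m = cantor_pair_measurable[OF s, of q b]
  interpret D: prob_space ?D by (rule P.prob_space_distr[OF m])
  have sp: "space \<mu> = UNIV" using sets_eq_imp_space_eq[OF s] by simp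
  have fin: "finite {0..q - 1}" "{0..q - 1} \<noteq> {}" using q by auto
  have key: "emeasure ?D A =
      ennreal (1 / of_int q * (\<Sum>i\<in>{0..q - 1}. measure \<mu> (cantor_map q b i -` A)))"
    if A: "A \<in> sets borel" for A
  proof -
    have "emeasure ?D A = emeasure (measure_pmf (digit_pmf q) \<Otimes>\<^sub>M \<mu>)
        ((\<lambda>(i, x). cantor_map q b i x) -` A \<inter> space (measure_pmf (digit_pmf q) \<Otimes>\<^sub>M \<mu>))"
      by (rule emeasure_distr[OF m A])
    also have "\<dots> = (\<integral>\<^sup>+i. emeasure \<mu> (Pair i -`
        ((\<lambda>(i, x). cantor_map q b i x) -` A \<inter> space (measure_pmf (digit_pmf q) \<Otimes>\<^sub>M \<mu>))) \<partial>digit_pmf q)"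
      by (rule emeasure_pair_measure_alt[OF measurable_sets[OF m A]])
    also have "\<dots> = (\<integral>\<^sup>+i. ennreal (measure \<mu> (cantor_map q b i -` A)) \<partial>digit_pmf q)"
      by (intro nn_integral_cong)
         (auto simp: space_pair_measure sp vimage_def emeasure_eq_measure)
    also have "\<dots> = (\<Sum>i\<in>{0..q - 1}. ennreal (measure \<mu> (cantor_map q b i -` A))) / of_nat (card {0..q - 1})"
      unfolding digit_pmf_def using fin by (simp add: nn_integral_pmf_of_set)
    also have "\<dots> = ennreal (\<Sum>i\<in>{0..q - 1}. measure \<mu> (cantor_map q b i -` A)) / ennreal (of_int q)"
      using q by (simp add: sum_ennreal ennreal_of_nat_eq_real_of_nat)
    also have "\<dots> = ennreal (1 / of_int q * (\<Sum>i\<in>{0..q - 1}. measure \<mu> (cantor_map q b i -` A)))"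
      using q by (subst divide_ennreal) (auto intro: sum_nonneg)
    finally show ?thesis .
  qed
  have key': "measure ?D A =
      1 / of_int q * (\<Sum>i\<in>{0..q - 1}. measure \<mu> (cantor_map q b i -` A))"
    if A: "A \<in> sets borel" for A
    using key[OF A] q by (simp add: measure_def sum_nonneg)
  show ?thesis
  proof
    assume "is_cantor_measure q b \<mu>"
    then show "\<mu> = ?D"
      using key s by (intro measure_eqI) (auto simp: is_cantor_measure_def emeasure_eq_measure)
  next
    assume "\<mu> = ?D"
    then show "is_cantor_measure q b \<mu>"
      unfolding is_cantor_measure_def using key' s p by metis
  qed
qed

lemma char_cantor:
  assumes q: "q \<ge> 1" and c: "is_cantor_measure q b \<mu>"
  shows "char \<mu> t = char (distr (measure_pmf (digit_pmf q)) borel (\<lambda>i. of_int i / of_int q)) t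
           * char \<mu> (t / of_int b)"
proof -
  from c have s [measurable_cong]: "sets \<mu> = sets borel" and p: "prob_space \<mu>"
    by (auto simp: is_cantor_measure_def)
  interpret prob_space \<mu> by fact
  interpret P: pair_prob_space "measure_pmf (digit_pmf q)" \<mu> ..
  note m = cantor_pair_measurable[OF s, of q b]
  let ?f = "\<lambda>z. iexp (t * (case z of (i, x) \<Rightarrow> cantor_map q b i x))"
  have mf: "?f \<in> borel_measurable (measure_pmf (digit_pmf q) \<Otimes>\<^sub>M \<mu>)"
    using m by measurable
  have int: "integrable (measure_pmf (digit_pmf q) \<Otimes>\<^sub>M \<mu>) ?f"
    by (rule P.integrable_const_bound[where B = 1]) (use mf in auto)
  have "char \<mu> t = char (distr (measure_pmf (digit_pmf q) \<Otimes>\<^sub>M \<mu>) borel (\<lambda>(i, x). cantor_map q b i x)) t"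
    using is_cantor_measure_iff_distr[OF q s p, of b] c by simp
  also have "\<dots> = (CLINT z|measure_pmf (digit_pmf q) \<Otimes>\<^sub>M \<mu>. ?f z)"
    unfolding char_def by (rule integral_distr[OF m]) auto
  also have "\<dots> = (CLINT i|measure_pmf (digit_pmf q). CLINT x|\<mu>. ?f (i, x))"
    by (rule P.integral_fst'[OF int, symmetric])
  also have "\<dots> = (CLINT i|measure_pmf (digit_pmf q).
      iexp (t * (of_int i / of_int q)) * (CLINT x|\<mu>. iexp (t / of_int b * x)))"
    by (intro Bochner_Integration.integral_cong refl)
       (simp add: cantor_map_def ring_distribs exp_add mult_ac flip: Bochner_Integration.integral_mult_right_zero)
  also have "\<dots> = char (distr (measure_pmf (digit_pmf q)) borel (\<lambda>i. of_int i / of_int q)) t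
           * char \<mu> (t / of_int b)"
    by (simp add: char_def integral_distr)
  finally show ?thesis .
qed

lemma is_cantor_measure_unique:
  assumes q: "q \<ge> 1" and b: "b \<ge> 2"
    and c1: "is_cantor_measure q b \<mu>" and c2: "is_cantor_measure q b \<nu>"
  shows "\<mu> = \<nu>"
proof (rule Levy_uniqueness)
  show r1: "real_distribution \<mu>" and r2: "real_distribution \<nu>"
    using c1 c2 by (auto simp: is_cantor_measure_def real_distribution_def
        real_distribution_axioms_def dest: sets_eq_imp_space_eq)
  interpret M: real_distribution \<mu> by fact
  interpret N: real_distribution \<nu> by fact
  let ?P = "distr (measure_pmf (digit_pmf q)) borel (\<lambda>i. of_int i / of_int q :: real)"
  interpret P: real_distribution ?P
    by (rule prob_space.real_distribution_distr[OF prob_space_measure_pmf]) simp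
  define d where "d t = cmod (char \<mu> t - char \<nu> t)" for t
  have step: "d t \<le> d (t / of_int b)" for t
  proof -
    have "d t = cmod (char ?P t) * d (t / of_int b)"
      unfolding d_def char_cantor[OF q c1, of t] char_cantor[OF q c2, of t]
      by (simp add: right_diff_distrib[symmetric] norm_mult)
    also have "\<dots> \<le> 1 * d (t / of_int b)"
      by (intro mult_right_mono P.cmod_char_le_1) (simp add: d_def)
    finally show ?thesis by simp
  qed
  have iter: "d t \<le> d (t / of_int b ^ n)" for t n
  proof (induction n)
    case (Suc n)
    show ?case using Suc step[of "t / of_int b ^ n"] by (simp add: field_simps)
  qed simp
  have "d t = 0" for t
  proof -
    have "(\<lambda>n. t / of_int b ^ n) \<longlonglongrightarrow> 0"
      using b by real_asymp
    moreover have "isCont d 0"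
      unfolding d_def by (intro continuous_intros M.isCont_char N.isCont_char)
    ultimately have "(\<lambda>n. d (t / of_int b ^ n)) \<longlonglongrightarrow> d 0"
      by (rule isCont_tendsto_compose[rotated])
    moreover have "d 0 = 0"
      by (simp add: d_def M.char_zero N.char_zero)
    ultimately have "d t \<le> 0"
      using iter by (intro LIMSEQ_le_const[of _ 0]) auto
    then show ?thesis by (simp add: d_def)
  qed
  then show "char \<mu> = char \<nu>"
    by (auto simp: d_def)
qed

lemma is_cantor_measure_exists:
  assumes q: "q \<ge> 1" and b: "b \<ge> 2"
  shows "\<exists>\<mu>. is_cantor_measure q b \<mu>"
proof -
  let ?P = "measure_pmf (digit_pmf q)"
  let ?S = "stream_space ?P"
  define X :: "int stream \<Rightarrow> real"
    where "X s = (\<Sum>n. (if s !! n \<in> {0..q - 1} then of_int (s !! n) / of_int q else 0) / of_int b ^ n)" for s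
  interpret S: prob_space ?S by (rule prob_space.prob_space_stream_space[OF prob_space_measure_pmf])
  have Xm [measurable]: "X \<in> borel_measurable ?S"
    unfolding X_def
    by (intro borel_measurable_suminf measurable_compose[OF measurable_snth[of _ ?P]]) simp
  define \<mu> where "\<mu> = distr ?S borel X"
  have s: "sets \<mu> = sets borel" by (simp add: \<mu>_def)
  have p: "prob_space \<mu>" unfolding \<mu>_def by (rule S.prob_space_distr) simp
  interpret prob_space \<mu> by fact
  note m = cantor_pair_measurable[OF s, of q b]
  have summ: "summable (\<lambda>n. (if s !! n \<in> {0..q - 1} then of_int (s !! n) / of_int q else 0) / of_int b ^ n :: real)" for s
  proof (rule summable_comparison_test')
    show "summable (\<lambda>n. (1 / of_int b :: real) ^ n)" using b by (simp add: summable_geometric)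
    show "norm ((if s !! n \<in> {0..q - 1} then of_int (s !! n) / of_int q else 0) / of_int b ^ n :: real)
        \<le> (1 / of_int b) ^ n" if "n \<ge> 0" for n
      using q b by (auto simp: power_divide divide_simps)
  qed
  have X_Stream: "X (i ## s) = cantor_map q b i (X s)" if "i \<in> {0..q - 1}" for i s
  proof -
    let ?t = "\<lambda>s n. (if s !! n \<in> {0..q - 1} then of_int (s !! n) / of_int q else 0) / of_int b ^ n :: real"
    have "X (i ## s) = (\<Sum>n. ?t (i ## s) (Suc n)) + ?t (i ## s) 0"
      unfolding X_def using suminf_split_head[OF summ, of "i ## s"] by simp
    also have "(\<lambda>n. ?t (i ## s) (Suc n)) = (\<lambda>n. ?t s n / of_int b)"
      by (simp add: fun_eq_iff)
    also have "(\<Sum>n. ?t s n / of_int b) = X s / of_int b"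
      unfolding X_def by (rule suminf_divide[OF summ])
    finally show ?thesis using that by (simp add: cantor_map_def)
  qed
  have "\<mu> = distr (?P \<Otimes>\<^sub>M \<mu>) borel (\<lambda>(i, x). cantor_map q b i x)"
  proof (rule measure_eqI)
    fix A assume "A \<in> sets \<mu>"
    then have A [measurable]: "A \<in> sets borel" by (simp add: s)
    have AE: "AE i in ?P. i \<in> {0..q - 1}"
      using q by (auto simp: AE_measure_pmf_iff digit_pmf_def)
    have [measurable]: "cantor_map q b i -` A \<in> sets borel" for i
      by (rule cantor_map_vimage_sets) fact
    have "emeasure \<mu> A = (\<integral>\<^sup>+s. indicator A (X s) \<partial>?S)"
      unfolding \<mu>_def by (simp add: nn_integral_distr flip: nn_integral_indicator)
    also have "\<dots> = (\<integral>\<^sup>+i. \<integral>\<^sup>+s. indicator A (X (i ## s)) \<partial>?S \<partial>?P)"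
      by (rule prob_space.nn_integral_stream_space[OF prob_space_measure_pmf]) measurable
    also have "\<dots> = (\<integral>\<^sup>+i. \<integral>\<^sup>+s. indicator (cantor_map q b i -` A) (X s) \<partial>?S \<partial>?P)"
      using AE by (intro nn_integral_cong_AE) (auto simp: X_Stream indicator_def)
    also have "\<dots> = (\<integral>\<^sup>+i. emeasure \<mu> (cantor_map q b i -` A) \<partial>?P)"
      unfolding \<mu>_def by (simp add: nn_integral_distr flip: nn_integral_indicator)
    also have "\<dots> = emeasure (distr (?P \<Otimes>\<^sub>M \<mu>) borel (\<lambda>(i, x). cantor_map q b i x)) A"
      unfolding emeasure_distr[OF m A] emeasure_pair_measure_alt[OF measurable_sets[OF m A]]
      using sets_eq_imp_space_eq[OF s]
      by (intro nn_integral_cong) (auto simp: space_pair_measure vimage_def)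
    finally show "emeasure \<mu> A = emeasure (distr (?P \<Otimes>\<^sub>M \<mu>) borel (\<lambda>(i, x). cantor_map q b i x)) A" .
  qed (simp add: s)
  then show ?thesis
    using is_cantor_measure_iff_distr[OF q s p] by blast
qed

theorem is_cantor_measure_cantor_measure:
  assumes "q \<ge> 1" "b \<ge> 2"
  shows "is_cantor_measure q b (cantor_measure q b)"
  unfolding cantor_measure_def
  using is_cantor_measure_exists[OF assms] is_cantor_measure_unique[OF assms]
  by (blast intro: theI)


section \<open>Orthogonal sets\<close>

definition L2_inner :: "real measure \<Rightarrow> (real \<Rightarrow> complex) \<Rightarrow> (real \<Rightarrow> complex) \<Rightarrow> complex" where
  "L2_inner \<mu> f g = (CLINT x|\<mu>. f x * cnj (g x))"

definition expo :: "real \<Rightarrow> real \<Rightarrow> complex" where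
  "expo l x = exp (- 2 * of_real pi * \<i> * of_real l * of_real x)"

definition orthogonal_set :: "real measure \<Rightarrow> real set \<Rightarrow> bool" where
  "orthogonal_set \<mu> L \<longleftrightarrow>
     countable L \<and> pairwise (\<lambda>l l'. L2_inner \<mu> (expo l) (expo l') = 0) L"

definition maximal_orthogonal_set :: "real measure \<Rightarrow> real set \<Rightarrow> bool" where
  "maximal_orthogonal_set \<mu> L \<longleftrightarrow>
     orthogonal_set \<mu> L \<and> (\<forall>l\<^sub>0. l\<^sub>0 \<notin> L \<longrightarrow> \<not> orthogonal_set \<mu> (L \<union> {l\<^sub>0}))"


section \<open>Words and tree mappings\<close>

text \<open>Finite words are lists and infinite words are streams over the alphabet; the prefix of
  length \<open>k\<close> of an infinite word is given by \<^const>\<open>stake\<close>.\<close>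

definition alphabet :: "int \<Rightarrow> int set" where
  "alphabet q = {0..q - 1}"

definition words :: "int \<Rightarrow> int list set" where
  "words q = {w. w \<noteq> [] \<and> set w \<subseteq> alphabet q}"

definition word_prefix :: "nat \<Rightarrow> int list \<Rightarrow> int list" where
  "word_prefix k w = stake k (w @- sconst 0)"

text \<open>A tree mapping is only constrained on \<^const>\<open>words\<close>; its values on other lists are
  irrelevant.\<close>

definition tree_mapping :: "int \<Rightarrow> int \<Rightarrow> (int list \<Rightarrow> int) \<Rightarrow> bool" where
  "tree_mapping q b \<tau> \<longleftrightarrow>
     (\<forall>w\<in>words q. \<tau> w \<in> {-1..b - 2}) \<and>
     (\<forall>n\<ge>1. \<tau> (replicate n 0) = 0) \<and>
     (\<forall>w\<in>words q. \<exists>k. \<tau> w = last w + q * k)"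

definition maximal_tree_mapping :: "int \<Rightarrow> int \<Rightarrow> (int list \<Rightarrow> int) \<Rightarrow> bool" where
  "maximal_tree_mapping q b \<tau> \<longleftrightarrow>
     tree_mapping q b \<tau> \<and>
     (\<forall>w\<in>words q. \<exists>w'\<in>words q. \<forall>\<^sub>F n in sequentially. \<tau> (word_prefix n (w @ w')) = 0)"

text \<open>The summation index is shifted by one; only finitely many terms of the series are nonzero.\<close>

definition tree_spectrum :: "int \<Rightarrow> int \<Rightarrow> (int list \<Rightarrow> int) \<Rightarrow> real set" where
  "tree_spectrum q b \<tau> =
     {(\<Sum>n. of_int (\<tau> (word_prefix (Suc n) w)) * of_int b ^ n) | w.
        w \<in> words q \<and> (\<forall>\<^sub>F m in sequentially. \<tau> (word_prefix m w) = 0)}"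

end

theory Submission
  imports Defs
begin

text \<open>
  The Fourier transform of the Cantor measure vanishes exactly on the integers \<open>b ^ n * a\<close> with
  \<open>q\<close> not dividing \<open>a\<close>. If an integer \<open>x\<close> can be adjoined to the scaled spectrum, then \<open>x\<close> can be
  expanded in base \<open>b\<close> with digits \<open>K\<close> times the values of \<open>\<tau>\<close> along an infinite word. As \<open>K\<close> is
  invertible modulo \<open>b\<close>, each remainder determines the next digit and the next remainder, and the
  remainders are bounded integers, hence eventually periodic; a nonzero remainder \<open>r\<close> on the cycle
  gives \<open>i = - r\<close>. Conversely, a periodic tail of digits with value \<open>i / K\<close> sums \<open>b\<close>-adically to
  the integer \<open>- i\<close>, so the word represents an integer \<open>x\<close>, which differs from each element of the
  scaled spectrum by a zero, read off at the first letter where the two words disagree.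
\<close>

section \<open>Zeros of the Fourier transform of the Cantor measure\<close>

definition cantor_zeros :: "int \<Rightarrow> int \<Rightarrow> real set" where
  "cantor_zeros q b = {of_int (b ^ n * a) | n a. \<not> q dvd a}"

lemma zero_notin_cantor_zeros:
  assumes "b \<noteq> 0"
  shows "0 \<notin> cantor_zeros q b"
  using assms by (auto simp: cantor_zeros_def)

lemma uminus_in_cantor_zeros_iff: "- x \<in> cantor_zeros q b \<longleftrightarrow> x \<in> cantor_zeros q b"
proof -
  have "- x \<in> cantor_zeros q b" if "x \<in> cantor_zeros q b" for x
  proof -
    from that obtain n a where "x = of_int (b ^ n * a)" "\<not> q dvd a"
      by (auto simp: cantor_zeros_def)
    then have "- x = of_int (b ^ n * (- a))" "\<not> q dvd - a"
      by auto
    then show ?thesis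
      unfolding cantor_zeros_def by blast
  qed
  from this[of x] this[of "- x"] show ?thesis by auto
qed

text \<open>In a representation \<open>b ^ m * a\<close> of the left side with \<open>m\<close> at
  most \<open>n\<close>, \<open>q\<close> would divide \<open>a\<close>; hence \<open>m\<close>
  exceeds \<open>n\<close>. This is what later upgrades divisibility by \<open>q\<close> to
  divisibility by \<open>b\<close>.\<close>

lemma of_int_power_mult_in_cantor_zeros_iff:
  assumes "b \<noteq> 0" "q dvd b" "q dvd y"
  shows "of_int (b ^ n * y) \<in> cantor_zeros q b \<longleftrightarrow> (\<exists>k a. y = b ^ Suc k * a \<and> \<not> q dvd a)"
proof
  assume "of_int (b ^ n * y) \<in> cantor_zeros q b"
  then obtain m a where eq: "b ^ n * y = b ^ m * a" and a: "\<not> q dvd a"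
    unfolding cantor_zeros_def by (auto simp flip: of_int_mult of_int_power)
  have "n < m"
  proof (rule ccontr)
    assume "\<not> n < m"
    then have "b ^ m * (b ^ (n - m) * y) = b ^ m * a"
      using eq by (simp flip: power_add mult.assoc)
    then have "a = b ^ (n - m) * y"
      using assms by simp
    then show False
      using a assms by simp
  qed
  then have "b ^ n * y = b ^ n * (b ^ Suc (m - Suc n) * a)"
    using eq by (simp only: Suc_diff_Suc mult.assoc[symmetric] power_add[symmetric]) simp
  then have "y = b ^ Suc (m - Suc n) * a"
    using assms(1) by (simp del: power_Suc)
  with a show "\<exists>k a. y = b ^ Suc k * a \<and> \<not> q dvd a" by blast
next
  assume "\<exists>k a. y = b ^ Suc k * a \<and> \<not> q dvd a"
  then obtain k a where "y = b ^ Suc k * a" "\<not> q dvd a" by blast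
  then have "of_int (b ^ n * y) = real_of_int (b ^ (n + Suc k) * a)"
    by (simp only: power_add mult.assoc)
  with \<open>\<not> q dvd a\<close> show "of_int (b ^ n * y) \<in> cantor_zeros q b"
    unfolding cantor_zeros_def by blast
qed

section \<open>Vanishing of the characteristic functions\<close>

lemma exp_2pi_eq_1_iff: "iexp (2 * pi * x) = 1 \<longleftrightarrow> x \<in> \<int>"
  by (auto simp: exp_eq_1 Ints_def)

lemma char_digit_pmf:
  assumes "q \<ge> 1"
  shows "char (distr (measure_pmf (digit_pmf q)) borel (\<lambda>i. of_int i / of_int q)) t
    = (\<Sum>k<nat q. iexp (t / of_int q) ^ k) / of_int q"
proof -
  have "char (distr (measure_pmf (digit_pmf q)) borel (\<lambda>i. of_int i / of_int q)) t
      = (CLINT i|measure_pmf (digit_pmf q). iexp (t * (of_int i / of_int q)))"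
    by (simp add: char_def integral_distr)
  also have "\<dots> = (\<Sum>i\<in>{0..q - 1}. pmf (digit_pmf q) i *\<^sub>R iexp (t * (of_int i / of_int q)))"
    using assms by (intro integral_measure_pmf) (auto simp: digit_pmf_def)
  also have "\<dots> = (\<Sum>i\<in>{0..q - 1}. iexp (t * (of_int i / of_int q))) / of_int q"
    using assms by (simp add: digit_pmf_def sum_divide_distrib scaleR_conv_of_real)
  also have "(\<Sum>i\<in>{0..q - 1}. iexp (t * (of_int i / of_int q)))
      = (\<Sum>k<nat q. iexp (t / of_int q) ^ k)"
    using assms
    by (intro sum.reindex_bij_witness[of _ int nat])
       (auto simp: nat_less_iff field_simps simp flip: exp_of_nat_mult)
  finally show ?thesis .
qed

text \<open>Up to the factor \<open>1 / q\<close> this is a geometric sum in z = exp(2 pi i x / q),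
  which vanishes exactly when z is a \<open>q\<close>-th root of unity other than 1.\<close>

lemma char_digit_pmf_eq_0_iff:
  assumes "q \<ge> 1"
  shows "char (distr (measure_pmf (digit_pmf q)) borel (\<lambda>i. of_int i / of_int q)) (2 * pi * x) = 0
    \<longleftrightarrow> (\<exists>a. x = of_int a \<and> \<not> q dvd a)"
proof -
  define z where "z = iexp (2 * pi * (x / of_int q))"
  have "z ^ nat q = iexp (2 * pi * x)"
    using assms by (simp add: z_def field_simps flip: exp_of_nat_mult)
  then have zq: "z ^ nat q = 1 \<longleftrightarrow> x \<in> \<int>"
    by (simp add: exp_2pi_eq_1_iff del: of_real_mult)
  have z1: "z = 1 \<longleftrightarrow> x / of_int q \<in> \<int>"
    unfolding z_def by (rule exp_2pi_eq_1_iff)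
  have div: "of_int a / of_int q \<in> (\<int> :: real set) \<longleftrightarrow> q dvd a" for a
  proof
    assume "of_int a / of_int q \<in> (\<int> :: real set)"
    then obtain c :: int where "of_int a / of_int q = real_of_int c" by (auto elim: Ints_cases)
    then have "real_of_int a = of_int (c * q)" using assms by (simp add: field_simps)
    then show "q dvd a" by (simp only: of_int_eq_iff dvd_triv_right)
  next
    assume "q dvd a"
    then show "of_int a / of_int q \<in> (\<int> :: real set)" using assms by auto
  qed
  have "(\<Sum>k<nat q. z ^ k) = 0 \<longleftrightarrow> z \<noteq> 1 \<and> z ^ nat q = 1"
    using assms by (cases "z = 1") (auto simp: geometric_sum)
  also have "\<dots> \<longleftrightarrow> (\<exists>a. x = of_int a \<and> \<not> q dvd a)"
    unfolding zq z1 using div by (metis Ints_cases Ints_of_int)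
  finally show ?thesis
    using assms by (simp add: char_digit_pmf z_def)
qed

text \<open>Self-similarity, iterated, gives finitely many digit factors times a value near the
  origin. That value is nonzero for large \<open>n\<close> by continuity, so every zero is a zero of
  some digit factor.\<close>

lemma char_cantor_eq_0_iff:
  assumes q: "q \<ge> 1" and b: "b \<ge> 2" and c: "is_cantor_measure q b \<mu>"
  shows "char \<mu> (2 * pi * x) = 0 \<longleftrightarrow> x \<in> cantor_zeros q b"
proof -
  interpret real_distribution \<mu>
    using c by (auto simp: is_cantor_measure_def real_distribution_def
        real_distribution_axioms_def dest: sets_eq_imp_space_eq)
  let ?m = "char (distr (measure_pmf (digit_pmf q)) borel (\<lambda>i. of_int i / of_int q :: real))"
  have expand: "char \<mu> t = (\<Prod>k<n. ?m (t / of_int b ^ k)) * char \<mu> (t / of_int b ^ n)" for t n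
  proof (induction n)
    case (Suc n)
    then show ?case
      using char_cantor[OF q c, of "t / of_int b ^ n"] by (simp add: field_simps)
  qed simp
  have "(\<lambda>n. 2 * pi * x / of_int b ^ n) \<longlonglongrightarrow> 0"
    using b by real_asymp
  from isCont_tendsto_compose[OF isCont_char this]
  have "(\<lambda>n. char \<mu> (2 * pi * x / of_int b ^ n)) \<longlonglongrightarrow> 1"
    by (simp add: char_zero)
  then have "\<forall>\<^sub>F n in sequentially. char \<mu> (2 * pi * x / of_int b ^ n) \<noteq> 0"
    by (rule tendsto_imp_eventually_ne) simp
  then obtain N where N: "char \<mu> (2 * pi * x / of_int b ^ n) \<noteq> 0" if "n \<ge> N" for n
    by (auto simp: eventually_sequentially)
  have m0: "?m (2 * pi * x / of_int b ^ n) = 0 \<longleftrightarrow> (\<exists>a. x = of_int (b ^ n * a) \<and> \<not> q dvd a)" for n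
    using char_digit_pmf_eq_0_iff[OF q, of "x / of_int b ^ n"] b by (auto simp: field_simps)
  have "char \<mu> (2 * pi * x) = 0 \<longleftrightarrow> (\<exists>n. ?m (2 * pi * x / of_int b ^ n) = 0)"
  proof
    assume "char \<mu> (2 * pi * x) = 0"
    then show "\<exists>n. ?m (2 * pi * x / of_int b ^ n) = 0"
      using expand[of "2 * pi * x" N] N[of N] by auto
  next
    assume "\<exists>n. ?m (2 * pi * x / of_int b ^ n) = 0"
    then obtain n where "?m (2 * pi * x / of_int b ^ n) = 0" ..
    then show "char \<mu> (2 * pi * x) = 0"
      using expand[of "2 * pi * x" "Suc n"] by simp
  qed
  then show ?thesis
    unfolding m0 cantor_zeros_def by auto
qed

lemma L2_inner_expo: "L2_inner \<mu> (expo l) (expo l') = char \<mu> (2 * pi * (l' - l))"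
  unfolding L2_inner_def char_def
  by (intro Bochner_Integration.integral_cong refl)
     (simp add: expo_def exp_cnj algebra_simps flip: exp_add)

lemma orthogonal_set_cantor_measure_iff:
  assumes "q \<ge> 1" "b \<ge> 2"
  shows "orthogonal_set (cantor_measure q b) L
    \<longleftrightarrow> countable L \<and> pairwise (\<lambda>l l'. l' - l \<in> cantor_zeros q b) L"
  unfolding orthogonal_set_def L2_inner_expo
    char_cantor_eq_0_iff[OF assms is_cantor_measure_cantor_measure[OF assms]] ..


section \<open>Partial sums along infinite words\<close>

locale cantor_tree =
  fixes q b :: int and \<tau> :: "int list \<Rightarrow> int"
  assumes q_ge: "q \<ge> 2" and q_dvd: "q dvd b" and quot_ge: "b div q \<ge> 2"
    and tree: "tree_mapping q b \<tau>"
begin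

lemma b_ge: "b \<ge> 4"
proof -
  have "b = q * (b div q)" using q_dvd by simp
  also have "\<dots> \<ge> 2 * 2" using q_ge quot_ge by (intro mult_mono) auto
  finally show ?thesis by simp
qed

text \<open>Positions count from 0, so that the digit matches the letter \<open>s !! k\<close> and
  is the coefficient of \<open>b ^ k\<close>.\<close>

definition digit :: "int stream \<Rightarrow> nat \<Rightarrow> int" where
  "digit s k = \<tau> (stake (Suc k) s)"

text \<open>Finite sums keep everything in the integers, also along words whose digit series
  diverges in the reals.\<close>

definition tree_sum :: "int stream \<Rightarrow> nat \<Rightarrow> int" where
  "tree_sum s n = (\<Sum>k<n. digit s k * b ^ k)"

lemma tree_sum_0 [simp]: "tree_sum s 0 = 0"
  by (simp add: tree_sum_def)

lemma tree_sum_Suc: "tree_sum s (Suc n) = tree_sum s n + b ^ n * digit s n"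
  by (simp add: tree_sum_def mult.commute)

lemma stake_in_words:
  assumes "s \<in> streams (alphabet q)"
  shows "stake (Suc n) s \<in> words q"
  using assms streams_iff_snth[of s "alphabet q"]
  by (auto simp: words_def set_conv_nth simp del: stake.simps)

lemma shift_zeros_in_streams:
  assumes "w \<in> words q"
  shows "w @- sconst 0 \<in> streams (alphabet q)"
  using assms q_ge by (intro shift_streams) (auto simp: words_def streams_iff_snth alphabet_def)

lemma digit_bounds:
  assumes "s \<in> streams (alphabet q)"
  shows "digit s k \<in> {-1..b - 2}"
  using tree stake_in_words[OF assms] by (auto simp: digit_def tree_mapping_def)

lemma dvd_digit_minus_snth:
  assumes "s \<in> streams (alphabet q)"
  shows "q dvd digit s k - s !! k"
proof -
  have "last (stake (Suc k) s) = s !! k"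
    by (simp add: stake_Suc del: stake.simps)
  then show ?thesis
    using tree stake_in_words[OF assms, of k] unfolding digit_def tree_mapping_def by force
qed

lemma snth_bounds:
  assumes "s \<in> streams (alphabet q)"
  shows "s !! k \<in> {0..q - 1}"
  using assms by (simp add: streams_iff_snth alphabet_def)

lemma digit_sconst_0 [simp]: "digit (sconst 0) k = 0"
proof -
  have "stake (Suc k) (sconst 0) = replicate (Suc k) (0 :: int)"
    by (intro nth_equalityI) (auto simp del: stake.simps stake_siterate replicate.simps)
  then show ?thesis
    using tree by (simp add: digit_def tree_mapping_def del: stake.simps stake_siterate replicate.simps)
qed

lemma digit_cong:
  assumes "\<And>j. j \<le> k \<Longrightarrow> s !! j = s' !! j"
  shows "digit s k = digit s' k"
proof -
  have "stake (Suc k) s = stake (Suc k) s'"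
    using assms by (intro nth_equalityI) (auto simp del: stake.simps)
  then show ?thesis by (simp add: digit_def)
qed

lemma tree_sum_cong:
  assumes "\<And>j. j < n \<Longrightarrow> s !! j = s' !! j"
  shows "tree_sum s n = tree_sum s' n"
  unfolding tree_sum_def using assms by (intro sum.cong refl arg_cong2[where f = "(*)"] digit_cong) auto

lemma tree_sum_split: "\<exists>c. tree_sum s (n + m) = tree_sum s n + b ^ n * c"
proof (induction m)
  case (Suc m)
  then obtain c where "tree_sum s (n + m) = tree_sum s n + b ^ n * c" ..
  then have "tree_sum s (n + Suc m) = tree_sum s n + b ^ n * (c + b ^ m * digit s (n + m))"
    by (simp add: tree_sum_Suc power_add algebra_simps)
  then show ?case ..
qed (auto intro: exI[of _ 0])

lemma tree_sum_split_digit: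
  assumes "n < m"
  shows "\<exists>c. tree_sum s m = tree_sum s n + b ^ n * (digit s n + b * c)"
proof -
  obtain c where "tree_sum s m = tree_sum s (Suc n) + b ^ Suc n * c"
    using tree_sum_split[of s "Suc n" "m - Suc n"] assms by auto
  then show ?thesis
    by (intro exI[of _ c]) (simp add: tree_sum_Suc algebra_simps)
qed

lemma tree_sum_eventually_const:
  assumes "\<And>k. k \<ge> n \<Longrightarrow> digit s k = 0" "m \<ge> n"
  shows "tree_sum s m = tree_sum s n"
  unfolding tree_sum_def using assms by (intro sum.mono_neutral_right) auto

text \<open>A letter lies in \<open>{0..q - 1}\<close> and is congruent to its digit modulo
  \<open>q\<close>, so a vanishing digit forces the letter 0. Infinite words whose digits eventually
  vanish are therefore finite words followed by zeros.\<close>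

lemma tree_spectrum_eq:
  "tree_spectrum q b \<tau> =
    {of_int (tree_sum s n) | s n. s \<in> streams (alphabet q) \<and> (\<forall>k\<ge>n. digit s k = 0)}"
proof (intro set_eqI iffI)
  fix x assume "x \<in> tree_spectrum q b \<tau>"
  then obtain w where w: "w \<in> words q" and ev: "\<forall>\<^sub>F m in sequentially. \<tau> (word_prefix m w) = 0"
    and x: "x = (\<Sum>n. of_int (\<tau> (word_prefix (Suc n) w)) * of_int b ^ n)"
    by (auto simp: tree_spectrum_def)
  define s where "s = w @- sconst 0"
  have d: "\<tau> (word_prefix (Suc n) w) = digit s n" for n
    by (simp add: word_prefix_def digit_def s_def)
  from ev obtain n where "\<tau> (word_prefix m w) = 0" if "m \<ge> n" for m
    by (auto simp: eventually_sequentially)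
  then have n: "digit s k = 0" if "k \<ge> n" for k
    using that d[of k] by simp
  have "x = (\<Sum>k<n. of_int (digit s k) * of_int b ^ k)"
    unfolding x d by (rule suminf_finite) (auto simp: n)
  then have "x = of_int (tree_sum s n)"
    by (simp add: tree_sum_def)
  then show "x \<in> {of_int (tree_sum s n) | s n. s \<in> streams (alphabet q) \<and> (\<forall>k\<ge>n. digit s k = 0)}"
    using n shift_zeros_in_streams[OF w] s_def by blast
next
  fix x assume "x \<in> {real_of_int (tree_sum s n) | s n. s \<in> streams (alphabet q) \<and> (\<forall>k\<ge>n. digit s k = 0)}"
  then obtain s n where s: "s \<in> streams (alphabet q)" and n: "\<And>k. k \<ge> n \<Longrightarrow> digit s k = 0"
    and x: "x = of_int (tree_sum s n)" by auto
  have tail: "s !! k = 0" if "k \<ge> n" for k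
    using dvd_digit_minus_snth[OF s, of k] n[OF that] snth_bounds[OF s, of k]
      zdvd_not_zless[of "s !! k" q] by fastforce
  \<comment> \<open>Length \<open>Suc n\<close> instead of \<open>n\<close> keeps \<open>w\<close>
    nonempty when \<open>n\<close> is 0.\<close>
  define w where "w = stake (Suc n) s"
  have w: "w \<in> words q" unfolding w_def by (rule stake_in_words) fact
  have "sdrop (Suc n) s !! k = 0" for k
    unfolding sdrop_snth by (rule tail) simp
  then have "sdrop (Suc n) s = sconst 0"
    by (simp add: sconst_alt sset_range image_def del: sdrop.simps)
  then have "s = w @- sconst 0"
    using stake_sdrop[of "Suc n" s] by (simp add: w_def del: sdrop.simps stake.simps)
  then have d: "\<tau> (word_prefix (Suc k) w) = digit s k" for k
    by (simp add: word_prefix_def digit_def)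
  have "\<tau> (word_prefix m w) = 0" if "m \<ge> Suc n" for m
    using that d[of "m - 1"] n[of "m - 1"] by (cases m) auto
  then have "\<forall>\<^sub>F m in sequentially. \<tau> (word_prefix m w) = 0"
    by (auto simp: eventually_sequentially)
  moreover have "x = (\<Sum>n. of_int (\<tau> (word_prefix (Suc n) w)) * of_int b ^ n)"
    unfolding d x tree_sum_def using suminf_finite[of "{..<n}" "\<lambda>k. real_of_int (digit s k) * of_int b ^ k"]
    by (simp add: n)
  ultimately show "x \<in> tree_spectrum q b \<tau>"
    using w by (auto simp: tree_spectrum_def)
qed

lemma countable_tree_spectrum: "countable (tree_spectrum q b \<tau>)"
  by (rule countable_subset[of _ "range of_int"]) (auto simp: tree_spectrum_eq)

lemma zero_in_tree_spectrum: "0 \<in> tree_spectrum q b \<tau>"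
proof -
  have "sconst 0 \<in> streams (alphabet q)"
    using q_ge by (simp add: streams_iff_snth alphabet_def)
  then show ?thesis
    unfolding tree_spectrum_eq by (auto intro!: exI[of _ "sconst 0"] exI[of _ 0])
qed


text \<open>Below the first disagreement \<open>p\<close> everything cancels, and the quotient by
  \<open>b ^ p\<close> is, modulo \<open>q\<close>, \<open>K\<close> times the difference of two
  distinct letters. The arbitrary multiple of \<open>b ^ n\<close> is harmless as
  \<open>p < n\<close>; it is 0 when two elements of the spectrum are compared and carries the
  remainder \<open>- i\<close> of a periodic word.\<close>

lemma stream_sums_diverge:
  assumes s: "s \<in> streams (alphabet q)" and s': "s' \<in> streams (alphabet q)"
    and p: "s !! p \<noteq> s' !! p" and least: "\<And>j. j < p \<Longrightarrow> s !! j = s' !! j"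
    and nm: "p < n" "p < m" and K: "coprime K q"
  shows "of_int (K * tree_sum s n + b ^ n * c - K * tree_sum s' m) \<in> cantor_zeros q b"
proof -
  obtain c1 where c1: "tree_sum s n = tree_sum s p + b ^ p * (digit s p + b * c1)"
    using tree_sum_split_digit[OF nm(1)] by blast
  obtain c2 where c2: "tree_sum s' m = tree_sum s' p + b ^ p * (digit s' p + b * c2)"
    using tree_sum_split_digit[OF nm(2)] by blast
  have "b ^ n = b ^ p * (b * b ^ (n - Suc p))"
    using nm(1) by (simp flip: power_add power_Suc)
  then have eq: "K * tree_sum s n + b ^ n * c - K * tree_sum s' m
      = b ^ p * (K * (digit s p - digit s' p) + b * (K * c1 - K * c2 + b ^ (n - Suc p) * c))"
    unfolding c1 c2 tree_sum_cong[OF least, of p, simplified] by (simp add: algebra_simps)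
  have "\<not> q dvd K * (digit s p - digit s' p) + b * (K * c1 - K * c2 + b ^ (n - Suc p) * c)"
  proof
    assume "q dvd K * (digit s p - digit s' p) + b * (K * c1 - K * c2 + b ^ (n - Suc p) * c)"
    then have "q dvd K * (digit s p - digit s' p)"
      using q_dvd by (simp add: dvd_add_left_iff)
    then have "q dvd digit s p - digit s' p"
      using K by (simp add: coprime_commute coprime_dvd_mult_right_iff)
    moreover have "s !! p - s' !! p
        = (digit s p - digit s' p) - (digit s p - s !! p) + (digit s' p - s' !! p)"
      by simp
    ultimately have "q dvd s !! p - s' !! p"
      using dvd_digit_minus_snth[OF s, of p] dvd_digit_minus_snth[OF s', of p]
      by (metis dvd_add dvd_diff)
    then have "s !! p mod q = s' !! p mod q"
      by (simp add: mod_eq_dvd_iff)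
    then show False
      using p snth_bounds[OF s, of p] snth_bounds[OF s', of p] by simp
  qed
  then show ?thesis
    unfolding eq cantor_zeros_def by blast
qed

lemma streams_neq_least:
  assumes "s \<noteq> s'"
  obtains p where "s !! p \<noteq> s' !! p" "\<And>j. j < p \<Longrightarrow> s !! j = s' !! j"
proof -
  have "\<exists>p. s !! p \<noteq> s' !! p"
    using assms stream_smap_nats[of s] stream_smap_nats[of s'] by (metis ext)
  then show ?thesis
    using that LeastI_ex[of "\<lambda>p. s !! p \<noteq> s' !! p"] not_less_Least by blast
qed

end

section \<open>Extending a scaled spectrum\<close>

locale scaled_cantor_tree = cantor_tree +
  fixes K :: int
  assumes K_gt: "K > 1" and K_coprime: "coprime K b"
begin

lemma K_coprime_q: "coprime K q"
  using K_coprime q_dvd by (metis coprime_divisors dvd_refl)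

lemma tree_spectrum_scaled_orthogonal:
  assumes l: "l \<in> tree_spectrum q b \<tau>" and l': "l' \<in> tree_spectrum q b \<tau>" and "l \<noteq> l'"
  shows "of_int K * l - of_int K * l' \<in> cantor_zeros q b"
proof -
  obtain s n where s: "s \<in> streams (alphabet q)" "\<And>k. k \<ge> n \<Longrightarrow> digit s k = 0"
    and l_eq: "l = of_int (tree_sum s n)"
    using l by (auto simp: tree_spectrum_eq)
  obtain s' n' where s': "s' \<in> streams (alphabet q)" "\<And>k. k \<ge> n' \<Longrightarrow> digit s' k = 0"
    and l'_eq: "l' = of_int (tree_sum s' n')"
    using l' by (auto simp: tree_spectrum_eq)
  have "s \<noteq> s'"
    using \<open>l \<noteq> l'\<close> tree_sum_eventually_const[of n s "max n n'"]
      tree_sum_eventually_const[of n' s' "max n n'"] s s' l_eq l'_eq by auto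
  then obtain p where p: "s !! p \<noteq> s' !! p" "\<And>j. j < p \<Longrightarrow> s !! j = s' !! j"
    by (rule streams_neq_least) blast
  \<comment> \<open>A common length beyond the disagreement at which both sums are already
    complete.\<close>
  define m where "m = max (Suc p) (max n n')"
  have "l = of_int (tree_sum s m)" "l' = of_int (tree_sum s' m)"
    unfolding l_eq l'_eq using s(2) s'(2) tree_sum_eventually_const[of n s m]
      tree_sum_eventually_const[of n' s' m] by (simp_all add: m_def)
  then show ?thesis
    using stream_sums_diverge[OF s(1) s'(1) p, of m m K 0] K_coprime_q by (simp add: m_def)
qed

text \<open>Since 0 belongs to the spectrum and the zeros are integers, only integers can be adjoined
  to the scaled spectrum.\<close>

lemma not_maximal_scaled_iff:
  "\<not> maximal_orthogonal_set (cantor_measure q b) ((\<lambda>l. of_int K * l) ` tree_spectrum q b \<tau>)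
    \<longleftrightarrow> (\<exists>x :: int. \<forall>l\<in>tree_spectrum q b \<tau>. of_int x - of_int K * l \<in> cantor_zeros q b)"
    (is "\<not> maximal_orthogonal_set _ ?L \<longleftrightarrow> ?R")
proof -
  have qb: "q \<ge> 1" "b \<ge> 2" using q_ge b_ge by auto
  have "countable ?L" using countable_tree_spectrum by simp
  moreover have "pairwise (\<lambda>l l'. l' - l \<in> cantor_zeros q b) ?L"
    by (auto simp: pairwise_def intro!: tree_spectrum_scaled_orthogonal)
  ultimately have orth: "orthogonal_set (cantor_measure q b) ?L"
    by (simp add: orthogonal_set_cantor_measure_iff[OF qb])
  have flip: "of_int K * l - x \<in> cantor_zeros q b \<longleftrightarrow> x - of_int K * l \<in> cantor_zeros q b" for l x
    using uminus_in_cantor_zeros_iff[of "x - of_int K * l" q b] by simp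
  have ins: "orthogonal_set (cantor_measure q b) (?L \<union> {x})
      \<longleftrightarrow> (\<forall>l\<in>tree_spectrum q b \<tau>. x - of_int K * l \<in> cantor_zeros q b)"
    if "x \<notin> ?L" for x
    using that orth unfolding orthogonal_set_cantor_measure_iff[OF qb]
    by (auto simp: pairwise_insert flip)
  \<comment> \<open>For \<open>x\<close> in the scaled spectrum some difference is 0, which is not a
    zero of the transform.\<close>
  have nin: "x \<notin> ?L" if "\<forall>l\<in>tree_spectrum q b \<tau>. x - of_int K * l \<in> cantor_zeros q b" for x
    using that zero_notin_cantor_zeros[of b q] qb by force
  have "\<not> maximal_orthogonal_set (cantor_measure q b) ?L
      \<longleftrightarrow> (\<exists>x. \<forall>l\<in>tree_spectrum q b \<tau>. x - of_int K * l \<in> cantor_zeros q b)"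
    unfolding maximal_orthogonal_set_def using orth ins nin by blast
  also have "\<dots> \<longleftrightarrow> ?R"
  proof
    assume "\<exists>x. \<forall>l\<in>tree_spectrum q b \<tau>. x - of_int K * l \<in> cantor_zeros q b"
    then obtain x where x: "\<forall>l\<in>tree_spectrum q b \<tau>. x - of_int K * l \<in> cantor_zeros q b" ..
    then have "x \<in> cantor_zeros q b"
      using zero_in_tree_spectrum by fastforce
    then show ?R
      using x unfolding cantor_zeros_def by blast
  qed blast
  finally show ?thesis .
qed

section \<open>Base \<open>b\<close> expansions of integers with digits scaled by
  \<open>K\<close>\<close>

lemma digit_unique:
  assumes "t \<in> {-1..b - 2}" "u \<in> {-1..b - 2}" "b dvd y - K * t" "b dvd y - K * u"
  shows "t = u"
proof -
  have "b dvd K * (t - u)"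
    using dvd_diff[OF assms(4,3)] by (simp add: algebra_simps)
  \<comment> \<open>Shifted by one, the digits become the standard residues from 0 to
    \<open>b - 1\<close>.\<close>
  then have "b dvd (t + 1) - (u + 1)"
    using K_coprime by (simp add: coprime_commute coprime_dvd_mult_right_iff)
  then have "(t + 1) mod b = (u + 1) mod b"
    by (simp add: mod_eq_dvd_iff)
  then show ?thesis
    using assms by simp
qed

definition next_digit :: "int \<Rightarrow> int" where
  "next_digit y = (SOME t. t \<in> {-1..b - 2} \<and> b dvd y - K * t)"

lemma next_digit: "next_digit y \<in> {-1..b - 2}" "b dvd y - K * next_digit y"
proof -
  obtain J c where c: "1 = K * J + b * c"
    using bezout_int[of K b] K_coprime by (metis coprime_iff_gcd_eq_1 mult.commute)
  \<comment> \<open>\<open>J\<close> inverts \<open>K\<close> modulo \<open>b\<close>; the shift by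
    one reduces \<open>J * y\<close> into the range starting at -1.\<close>
  define t where "t = (J * y + 1) mod b - 1"
  have "y - K * t = b * (y * c + K * ((J * y + 1) div b))"
  proof -
    have "t = J * y - b * ((J * y + 1) div b)"
      unfolding t_def by (simp add: minus_mult_div_eq_mod[symmetric])
    then have "y - K * t = y * (1 - K * J) + b * (K * ((J * y + 1) div b))"
      by (simp only:) (simp add: algebra_simps)
    also have "1 - K * J = b * c" using c by simp
    finally show ?thesis by (simp add: algebra_simps)
  qed
  then have "b dvd y - K * t" by simp
  moreover have "t \<in> {-1..b - 2}"
    using b_ge pos_mod_bound[of b "J * y + 1"] pos_mod_sign[of b "J * y + 1"]
    unfolding t_def atLeastAtMost_iff by linarith
  ultimately show "next_digit y \<in> {-1..b - 2}" "b dvd y - K * next_digit y"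
    unfolding next_digit_def by (metis (mono_tags, lifting) someI)+
qed

text \<open>The division is exact: the lowest scaled digit is stripped and the quotient is the next
  remainder.\<close>

definition step :: "int \<Rightarrow> int" where
  "step y = (y - K * next_digit y) div b"

lemma step_eq: "b * step y = y - K * next_digit y"
  unfolding step_def using next_digit(2) by simp

lemma steps_expand:
  "y = K * (\<Sum>k<n. next_digit ((step ^^ k) y) * b ^ k) + b ^ n * (step ^^ n) y"
proof (induction n)
  case (Suc n)
  have "b ^ n * (step ^^ n) y = b ^ n * (K * next_digit ((step ^^ n) y) + b * (step ^^ Suc n) y)"
    by (simp add: step_eq)
  with Suc show ?case by (simp add: algebra_simps)
qed simp

text \<open>Digits have absolute value at most \<open>b - 1\<close>, so the new bound (B + B (b -
  1)) / b is again \<open>B\<close>.\<close>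

lemma step_bounded:
  assumes "\<bar>y\<bar> \<le> B" "K \<le> B"
  shows "\<bar>step y\<bar> \<le> B"
proof -
  have "b * \<bar>step y\<bar> = \<bar>y - K * next_digit y\<bar>"
    using b_ge by (simp add: abs_mult flip: step_eq)
  also have "\<dots> \<le> \<bar>y\<bar> + K * \<bar>next_digit y\<bar>"
    using K_gt abs_triangle_ineq4[of y "K * next_digit y"] by (simp add: abs_mult)
  also have "\<dots> \<le> B + B * (b - 1)"
    using assms K_gt b_ge next_digit(1)[of y] by (intro add_mono mult_mono) auto
  also have "\<dots> = b * B" by (simp add: algebra_simps)
  finally show ?thesis using b_ge by simp
qed

lemma steps_eventually_periodic:
  obtains M N where "N \<ge> 1" "(step ^^ (M + N)) x = (step ^^ M) x"
proof -
  \<comment> \<open>This bound dominates both the start \<open>x\<close> and \<open>K\<close>, so it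
    persists along the orbit and the pigeonhole principle applies.\<close>
  have "\<bar>(step ^^ n) x\<bar> \<le> \<bar>x\<bar> + K" for n
    by (induction n) (use K_gt in \<open>auto intro: step_bounded\<close>)
  then have "range (\<lambda>n. (step ^^ n) x) \<subseteq> {- (\<bar>x\<bar> + K)..\<bar>x\<bar> + K}"
    by (auto simp: abs_le_iff minus_le_iff)
  then have "\<not> inj (\<lambda>n. (step ^^ n) x)"
    by (meson finite_atLeastAtMost_int finite_subset range_inj_infinite)
  then obtain m n where "m < n" "(step ^^ n) x = (step ^^ m) x"
    unfolding inj_def by (metis nat_neq_iff)
  then show ?thesis
    using that[of "n - m" m] by simp
qed

lemma next_digit_0 [simp]: "next_digit 0 = 0"
  using digit_unique[of "next_digit 0" 0 0] next_digit[of 0] b_ge by simp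

lemma steps_0 [simp]: "(step ^^ n) 0 = 0"
  by (induction n) (simp_all add: step_def)


section \<open>From an adjoinable integer to a periodic word\<close>

text \<open>A tree mapping fixes the letter as the residue of its digit modulo \<open>q\<close>, so
  this is the only word along which \<tau> can produce the digits of the expansion of
  \<open>x\<close>.\<close>

definition remainder_word :: "int \<Rightarrow> int stream" where
  "remainder_word x = smap (\<lambda>y. next_digit y mod q) (siterate step x)"

lemma remainder_word_in_streams: "remainder_word x \<in> streams (alphabet q)"
  using q_ge by (auto simp: remainder_word_def streams_iff_snth alphabet_def intro: pos_mod_bound)

text \<open>A word of the spectrum that agrees with the remainder word up to position \<open>n\<close> leaves a
  difference \<open>b ^ n * y\<close> with \<open>q\<close> dividing \<open>y\<close>; being a zero, it forces \<open>b\<close> to divide \<open>y\<close>, and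
  the digit of \<open>\<tau>\<close> is then determined modulo \<open>b\<close>.\<close>

lemma digit_remainder_word:
  assumes maximal: "maximal_tree_mapping q b \<tau>"
    and x: "\<And>l. l \<in> tree_spectrum q b \<tau> \<Longrightarrow> of_int x - of_int K * l \<in> cantor_zeros q b"
  shows "digit (remainder_word x) n = next_digit ((step ^^ n) x)"
proof (induction n rule: less_induct)
  case (less n)
  let ?s = "remainder_word x" and ?y = "(step ^^ n) x"
  have s: "?s \<in> streams (alphabet q)" by (rule remainder_word_in_streams)
  \<comment> \<open>By the induction hypothesis the digits of \<tau> before position
    \<open>n\<close> are those of the expansion of \<open>x\<close>.\<close>
  have x_eq: "x = K * tree_sum ?s n + b ^ n * ?y"
    using steps_expand[of x n] less by (simp add: tree_sum_def)
  define w where "w = stake (Suc n) ?s"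
  have w: "w \<in> words q" unfolding w_def using s by (rule stake_in_words)
  \<comment> \<open>Maximality completes the prefix to a word whose digits eventually vanish, hence
    to an element of the spectrum.\<close>
  obtain w' where w': "w' \<in> words q" "\<forall>\<^sub>F m in sequentially. \<tau> (word_prefix m (w @ w')) = 0"
    using maximal w unfolding maximal_tree_mapping_def by blast
  define u where "u = (w @ w') @- sconst 0"
  have u: "u \<in> streams (alphabet q)"
    unfolding u_def using w w' by (intro shift_zeros_in_streams) (auto simp: words_def)
  obtain N0 where N0: "\<And>m. m \<ge> N0 \<Longrightarrow> \<tau> (word_prefix m (w @ w')) = 0"
    using w'(2) by (auto simp: eventually_sequentially)
  define N where "N = max (Suc n) N0"
  have "n < N" by (simp add: N_def)
  have dN: "digit u k = 0" if "k \<ge> N" for k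
    using N0[of "Suc k"] that unfolding digit_def u_def word_prefix_def N_def by (simp del: stake.simps)
  have agree: "u !! j = ?s !! j" if "j < Suc n" for j
    using that by (simp add: u_def w_def shift_append del: stake.simps)
  obtain c where c: "tree_sum u N = tree_sum u n + b ^ n * (digit u n + b * c)"
    using tree_sum_split_digit[of n N u] \<open>n < N\<close> by blast
  have u_sum: "tree_sum u n = tree_sum ?s n" and u_digit: "digit u n = digit ?s n"
    using agree by (auto intro: tree_sum_cong digit_cong)
  have "of_int (tree_sum u N) \<in> tree_spectrum q b \<tau>"
    using u dN unfolding tree_spectrum_eq by blast
  moreover define y where "y = ?y - K * digit ?s n - b * (K * c)"
  have "x - K * tree_sum u N = b ^ n * y"
    unfolding c u_sum u_digit y_def by (subst x_eq) (simp add: algebra_simps)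
  ultimately have zero: "of_int (b ^ n * y) \<in> cantor_zeros q b"
    using x by (metis of_int_diff of_int_mult)
  \<comment> \<open>Modulo \<open>q\<close> the digit of \<tau>, the letter and
    \<open>next_digit\<close> coincide, which yields \<open>q dvd y\<close>.\<close>
  have "q dvd digit ?s n - ?s !! n"
    using s by (rule dvd_digit_minus_snth)
  moreover have "q dvd ?s !! n - next_digit ?y"
    by (simp add: remainder_word_def mod_eq_dvd_iff[symmetric])
  moreover have "q dvd ?y - K * next_digit ?y"
    using q_dvd next_digit(2) by (rule dvd_trans)
  moreover have "y = (?y - K * next_digit ?y) - K * ((digit ?s n - ?s !! n) + (?s !! n - next_digit ?y))
      - b * (K * c)"
    by (simp add: y_def algebra_simps)
  ultimately have "q dvd y"
    using q_dvd by (metis dvd_add dvd_diff dvd_mult dvd_mult2)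
  with zero obtain k a where "y = b ^ Suc k * a"
    using of_int_power_mult_in_cantor_zeros_iff[of b q y n] q_dvd b_ge by auto
  then have "b dvd y + b * (K * c)" by simp
  then have "b dvd ?y - K * digit ?s n" by (simp add: y_def)
  then show ?case
    using digit_unique[of "digit ?s n" "next_digit ?y" ?y] digit_bounds[OF s, of n]
      next_digit[of ?y] by blast
qed

lemma periodic_word_if_extension:
  assumes maximal: "maximal_tree_mapping q b \<tau>"
    and x: "\<And>l. l \<in> tree_spectrum q b \<tau> \<Longrightarrow> of_int x - of_int K * l \<in> cantor_zeros q b"
  obtains s N M i where "s \<in> streams (alphabet q)" "N \<ge> 1"
    "\<And>k. k \<ge> M \<Longrightarrow> digit s (k + N) = digit s k"
    "i \<noteq> 0" "i * (b ^ N - 1) = K * (\<Sum>k<N. digit s (M + k) * b ^ k)"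
proof -
  define s where "s = remainder_word x"
  have s: "s \<in> streams (alphabet q)" unfolding s_def by (rule remainder_word_in_streams)
  have dig: "digit s n = next_digit ((step ^^ n) x)" for n
    unfolding s_def using maximal x by (rule digit_remainder_word)
  obtain M N where N: "N \<ge> 1" and per: "(step ^^ (M + N)) x = (step ^^ M) x"
    by (rule steps_eventually_periodic)
  have per': "(step ^^ (k + N)) x = (step ^^ k) x" if "k \<ge> M" for k
  proof -
    have "(step ^^ (k + N)) x = (step ^^ (k - M)) ((step ^^ (M + N)) x)"
      using that by (simp flip: funpow_add[THEN fun_cong, simplified])
    also have "\<dots> = (step ^^ k) x"
      unfolding per using that by (simp flip: funpow_add[THEN fun_cong, simplified])
    finally show ?thesis .
  qed
  let ?y = "(step ^^ M) x"
  have iter: "(step ^^ k) ?y = (step ^^ (M + k)) x" for k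
    by (simp add: add.commute flip: funpow_add[THEN fun_cong, simplified])
  \<comment> \<open>One turn around the cycle returns to the same remainder; solving for it gives
    the witness \<open>i = - ?y\<close>.\<close>
  have "?y = K * (\<Sum>k<N. digit s (M + k) * b ^ k) + b ^ N * ?y"
    using steps_expand[of ?y N] unfolding iter per dig .
  then have sum: "- ?y * (b ^ N - 1) = K * (\<Sum>k<N. digit s (M + k) * b ^ k)"
    by (simp add: algebra_simps)
  \<comment> \<open>Otherwise the expansion stops at \<open>M\<close> and \<open>x\<close> is
    \<open>K\<close> times an element of the spectrum, with difference 0.\<close>
  have "?y \<noteq> 0"
  proof
    assume y0: "?y = 0"
    then have "digit s k = 0" if "k \<ge> M" for k
      using dig[of k] iter[of "k - M"] that by simp
    then have "of_int (tree_sum s M) \<in> tree_spectrum q b \<tau>"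
      using s unfolding tree_spectrum_eq by blast
    moreover have "x = K * tree_sum s M"
      using steps_expand[of x M] y0 by (simp add: tree_sum_def dig)
    ultimately have "0 \<in> cantor_zeros q b"
      using x by fastforce
    then show False
      using zero_notin_cantor_zeros[of b q] b_ge by simp
  qed
  then show ?thesis
    using that[OF s N _ _ sum] per' by (simp add: dig)
qed

section \<open>From a periodic word to an adjoinable integer\<close>

text \<open>The integer is \<open>K\<close> times the \<open>b\<close>-adic value of the digit
  series: with S the value of the block, the repeated blocks contribute K S / (1 - b^N) = -i,
  shifted by \<open>b ^ M\<close>.\<close>

lemma extension_if_periodic_word:
  assumes s: "s \<in> streams (alphabet q)" and N: "N \<ge> 1"
    and per: "\<And>k. k \<ge> M \<Longrightarrow> digit s (k + N) = digit s k"
    and i: "i \<noteq> 0" "i * (b ^ N - 1) = K * (\<Sum>k<N. digit s (M + k) * b ^ k)"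
    and l: "l \<in> tree_spectrum q b \<tau>"
  shows "of_int (K * tree_sum s M - b ^ M * i) - of_int K * l \<in> cantor_zeros q b"
proof -
  let ?x = "K * tree_sum s M - b ^ M * i"
  have block: "tree_sum s (n + N) = tree_sum s n + b ^ n * (\<Sum>k<N. digit s (n + k) * b ^ k)" for n
    unfolding tree_sum_def
    by (induction N) (simp_all add: power_add algebra_simps)
  have per': "digit s (M + r * N + k) = digit s (M + k)" for r k
  proof (induction r)
    case (Suc r)
    then show ?case
      using per[of "M + r * N + k"] by (simp add: add_ac)
  qed simp
  \<comment> \<open>After every full period the remainder is again \<open>- i\<close>, so
    \<open>?x\<close> matches arbitrarily long partial sums.\<close>
  have x_eq: "?x = K * tree_sum s (M + r * N) - b ^ (M + r * N) * i" for r
  proof (induction r)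
    case (Suc r)
    have "K * tree_sum s (M + Suc r * N) - b ^ (M + Suc r * N) * i
        = K * tree_sum s (M + r * N) + b ^ (M + r * N)
            * (K * (\<Sum>k<N. digit s (M + k) * b ^ k) - b ^ N * i)"
      using block[of "M + r * N"] unfolding per'
      by (simp add: power_add algebra_simps)
    also have "\<dots> = ?x"
      unfolding i(2)[symmetric] Suc by (simp add: algebra_simps)
    finally show ?case ..
  qed simp
  obtain u n where u: "u \<in> streams (alphabet q)" "\<And>k. k \<ge> n \<Longrightarrow> digit u k = 0"
    and l_eq: "l = of_int (tree_sum u n)"
    using l by (auto simp: tree_spectrum_eq)
  \<comment> \<open>If the words agreed, the digits would vanish from \<open>n\<close> on, by
    periodicity the whole block would be zero, and \<open>i\<close> would be 0.\<close>
  have "s \<noteq> u"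
  proof
    assume "s = u"
    then have "digit s (M + n * N + k) = 0" for k
      using u(2)[of "M + n * N + k"] mult_le_mono2[OF N, of n] by simp
    then have "(\<Sum>k<N. digit s (M + k) * b ^ k) = 0"
      unfolding per' by simp
    moreover have "b ^ N > 1"
      using N b_ge by (intro one_less_power) auto
    ultimately show False
      using i by simp
  qed
  then obtain p where p: "s !! p \<noteq> u !! p" "\<And>j. j < p \<Longrightarrow> s !! j = u !! j"
    by (rule streams_neq_least) blast
  define m where "m = max (Suc p) n"
  have l_eq': "l = of_int (tree_sum u m)"
    unfolding l_eq using u(2) tree_sum_eventually_const[of n u m] by (simp add: m_def)
  \<comment> \<open>Since \<open>N\<close> is at least 1, \<open>Suc p\<close> periods reach beyond
    the first disagreement \<open>p\<close>.\<close>
  have "Suc p * 1 \<le> Suc p * N" using N by (intro mult_le_mono) auto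
  then have "p < Suc p * N" by (rule less_le_trans[rotated]) simp
  then have "p < M + Suc p * N" by (rule trans_less_add2)
  then have "of_int (K * tree_sum s (M + Suc p * N) + b ^ (M + Suc p * N) * (- i) - K * tree_sum u m)
      \<in> cantor_zeros q b"
    by (intro stream_sums_diverge[OF s u(1) p] K_coprime_q) (auto simp: m_def)
  moreover have "K * tree_sum s (M + Suc p * N) + b ^ (M + Suc p * N) * (- i) = ?x"
    using x_eq[of "Suc p"] by simp
  ultimately show ?thesis
    unfolding l_eq' by (metis of_int_diff of_int_mult)
qed

text \<open>The condition on \<open>i / K\<close> appears here cleared of denominators, as an
  equation between integers.\<close>

lemma not_maximal_scaled_iff_periodic:
  assumes "maximal_tree_mapping q b \<tau>"
  shows "\<not> maximal_orthogonal_set (cantor_measure q b) ((\<lambda>l. of_int K * l) ` tree_spectrum q b \<tau>)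
    \<longleftrightarrow> (\<exists>s\<in>streams (alphabet q). \<exists>M N. N \<ge> 1 \<and> (\<forall>k\<ge>M. digit s k = digit s (k + N)) \<and>
          (\<exists>i. i \<noteq> 0 \<and> i * (b ^ N - 1) = K * (\<Sum>k<N. digit s (M + k) * b ^ k)))"
    (is "_ \<longleftrightarrow> ?R")
  unfolding not_maximal_scaled_iff
proof
  assume "\<exists>x :: int. \<forall>l\<in>tree_spectrum q b \<tau>. of_int x - of_int K * l \<in> cantor_zeros q b"
  then obtain x :: int
    where x: "\<And>l. l \<in> tree_spectrum q b \<tau> \<Longrightarrow> of_int x - of_int K * l \<in> cantor_zeros q b" by blast
  show ?R
    by (rule periodic_word_if_extension[OF assms x]) (assumption, metis)
next
  assume ?R
  then obtain s M N i where "s \<in> streams (alphabet q)" "N \<ge> 1"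
    "\<And>k. k \<ge> M \<Longrightarrow> digit s (k + N) = digit s k"
    "i \<noteq> 0" "i * (b ^ N - 1) = K * (\<Sum>k<N. digit s (M + k) * b ^ k)"
    by metis
  from extension_if_periodic_word[OF this]
  show "\<exists>x :: int. \<forall>l\<in>tree_spectrum q b \<tau>. of_int x - of_int K * l \<in> cantor_zeros q b" by blast
qed

end

section \<open>The geometric series of a periodic block of digits\<close>

lemma periodic_expansion_sums:
  fixes b :: real and c :: "nat \<Rightarrow> real"
  assumes "b > 1" "N \<ge> 1"
  shows "(\<lambda>n. \<Sum>j = 1..N. c j * b powi (int j - int N * int (Suc n) - 1))
    sums ((\<Sum>j = 1..N. c j * b ^ (j - 1)) / (b ^ N - 1))"
proof -
  have bN: "b ^ N > 1" using assms by (simp add: one_less_power)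
  have "(\<lambda>n. (1 / b ^ N) ^ n) sums (1 / (1 - 1 / b ^ N))"
    using bN by (intro geometric_sums) simp
  then have "(\<lambda>n. (\<Sum>j = 1..N. c j * b ^ (j - 1)) / b ^ N * (1 / b ^ N) ^ n)
      sums ((\<Sum>j = 1..N. c j * b ^ (j - 1)) / b ^ N * (1 / (1 - 1 / b ^ N)))"
    by (rule sums_mult)
  moreover have "(\<Sum>j = 1..N. c j * b ^ (j - 1)) / b ^ N * (1 / (1 - 1 / b ^ N))
      = (\<Sum>j = 1..N. c j * b ^ (j - 1)) / (b ^ N - 1)"
  proof -
    have "1 - 1 / b ^ N = (b ^ N - 1) / b ^ N"
      using bN assms by (simp add: diff_divide_distrib)
    then show ?thesis
      using assms by simp
  qed
  moreover have "(\<Sum>j = 1..N. c j * b ^ (j - 1)) / b ^ N * (1 / b ^ N) ^ n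
      = (\<Sum>j = 1..N. c j * b powi (int j - int N * int (Suc n) - 1))" for n
  proof -
    have "c j * b ^ (j - 1) / b ^ N * (1 / b ^ N) ^ n
        = c j * b powi (int j - int N * int (Suc n) - 1)" if "j \<in> {1..N}" for j
    proof -
      \<comment> \<open>The exponent is negative; writing it as a difference of two naturals turns
        the integer power into a quotient of ordinary powers.\<close>
      have "int j - int N * int (Suc n) - 1 = int (j - 1) - int (N * Suc n)"
        using that by (simp add: of_nat_diff algebra_simps)
      then have "b powi (int j - int N * int (Suc n) - 1) = b ^ (j - 1) / b ^ (N * Suc n)"
        using assms power_int_diff[of b "int (j - 1)" "int (N * Suc n)"]
        by (simp only: power_int_of_nat) simp
      then show ?thesis
        by (simp add: power_add power_divide flip: power_mult)
    qed
    then show ?thesis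
      by (simp add: sum_divide_distrib sum_distrib_right)
  qed
  ultimately show ?thesis by (simp only:)
qed

theorem theorem5p1:
  fixes q b K :: int and \<tau> :: "int list \<Rightarrow> int"
  assumes "q \<ge> 2" and "q dvd b" and "b div q \<ge> 2"
    and "maximal_tree_mapping q b \<tau>"
    and "K > 1" and "coprime K b"
  shows "\<not> maximal_orthogonal_set (cantor_measure q b)
             ((\<lambda>l. of_int K * l) ` tree_spectrum q b \<tau>)
    \<longleftrightarrow>
    (\<exists>\<delta>\<in>streams (alphabet q). \<exists>M N :: nat. N \<ge> 1 \<and>
       (\<forall>n\<ge>M + 1. \<tau> (stake n \<delta>) = \<tau> (stake (n + N) \<delta>)) \<and>
       (let \<omega> = (\<lambda>j. \<tau> (stake (M + j) \<delta>)) in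
          (\<exists>i :: int. i \<noteq> 0 \<and>
             of_int i / of_int K =
               (\<Sum>n. \<Sum>j = 1..N. of_int (\<omega> j) * (of_int b :: real) powi (int j - int N * int (Suc n) - 1)) \<and>
             (\<Sum>n. \<Sum>j = 1..N. of_int (\<omega> j) * (of_int b :: real) powi (int j - int N * int (Suc n) - 1)) =
               (\<Sum>j = 1..N. of_int (\<omega> j) * of_int b ^ (j - 1)) / (of_int b ^ N - 1))))"
proof -
  interpret scaled_cantor_tree q b \<tau> K
    using assms by unfold_locales (auto simp: maximal_tree_mapping_def)
  \<comment> \<open>A prefix of length \<open>n\<close> ends at digit position
    \<open>n - 1\<close>.\<close>
  have per: "(\<forall>n\<ge>M + 1. \<tau> (stake n s) = \<tau> (stake (n + N) s))
      \<longleftrightarrow> (\<forall>k\<ge>M. digit s k = digit s (k + N))" for s M N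
    unfolding digit_def by (metis Suc_eq_plus1 Suc_le_D Suc_le_mono add_Suc)
  \<comment> \<open>The second equality always holds, by summing the geometric series; only the
    value of the block remains to be compared with \<open>i / K\<close>.\<close>
  have expansion: "of_int i / of_int K =
        (\<Sum>n. \<Sum>j = 1..N. of_int (\<tau> (stake (M + j) s)) * (of_int b :: real) powi (int j - int N * int (Suc n) - 1)) \<and>
      (\<Sum>n. \<Sum>j = 1..N. of_int (\<tau> (stake (M + j) s)) * (of_int b :: real) powi (int j - int N * int (Suc n) - 1)) =
        (\<Sum>j = 1..N. of_int (\<tau> (stake (M + j) s)) * of_int b ^ (j - 1)) / (of_int b ^ N - 1)
      \<longleftrightarrow> i * (b ^ N - 1) = K * (\<Sum>k<N. digit s (M + k) * b ^ k)"
    if "N \<ge> 1" for s M N i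
  proof -
    let ?S = "\<Sum>k<N. digit s (M + k) * b ^ k"
    have S: "(\<Sum>j = 1..N. of_int (\<tau> (stake (M + j) s)) * of_int b ^ (j - 1)) = real_of_int ?S"
      by (simp add: digit_def sum.atLeast1_atMost_eq del: stake.simps)
    have bN: "real_of_int b ^ N > 1"
      using b_ge that by (intro one_less_power) auto
    have "(of_int b :: real) > 1" using b_ge by simp
    note suminf = sums_unique[OF periodic_expansion_sums[OF this that], symmetric]
    have "of_int i / of_int K = real_of_int ?S / (of_int b ^ N - 1)
        \<longleftrightarrow> real_of_int i * (of_int b ^ N - 1) = of_int K * of_int ?S"
      using K_gt bN by (simp add: field_simps)
    also have "\<dots> \<longleftrightarrow> real_of_int (i * (b ^ N - 1)) = of_int (K * ?S)"
      by (simp only: of_int_mult of_int_diff of_int_power of_int_1)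
    finally show ?thesis
      unfolding suminf S of_int_eq_iff by simp
  qed
  show ?thesis
    unfolding not_maximal_scaled_iff_periodic[OF assms(4)] per Let_def
    by (intro bex_cong ex_cong1 conj_cong refl expansion[symmetric])
qed

end
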